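(* Let $G=(V,E)$ be a finite simple graph and let $f_0:V\to\mathbb{N}$ be injective with $\gcd(f_0(u),f_0(v))=1$ for every edge $uv\in E$. Fix a prime $p$ and let $g(x)=px+1$. For $t\ge 0$ define $f_t(v)=g^t(f_0(v))=p^t f_0(v)+c_t$, where $c_t=\frac{p^t-1}{p-1}$. Suppose that for every edge $uv\in E$ and every prime $q$ dividing $|f_0(v)-f_0(u)|$, one has $(p-1)f_0(u)+1\not\equiv p^k\pmod q$ for all $k\in\mathbb{Z}$, i.e. $(p-1)f_0(u)+1\notin\langle p\rangle\subset(\mathbb{Z}/q\mathbb{Z})^\times$. Then for all $t\ge 0$, $\gcd(f_t(u),f_t(v))=1$ for all $uv\in E$, and each $f_t$ is injective on $V$; that is, $(f_t)_{t\ge0}$ is a dynamic coprime labeling of $G$.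
   Context: $\mathbb{N}=\{1,2,3,\dots\}$; $g^t$ denotes the $t$-fold composition of $g$ ($g^0=\mathrm{id}$). A dynamic coprime labeling of $G=(V,E)$ with respect to a map $g$ is a sequence of injective labelings $f_t:V\to\mathbb{N}$ ($t\ge 0$) with $f_{t+1}=g\circ f_t$ and $\gcd(f_t(u),f_t(v))=1$ for every edge $uv\in E$ and every $t\ge 0$. *)

theory Defs
  imports
    "HOL-Number_Theory.Residues"
    "HOL-Algebra.Generated_Groups"
    "Graph_Theory.Pair_Digraph"
begin

text \<open>
  A finite simple graph is a \<^locale>\<open>pair_graph\<close>: a finite set of vertices with a symmetric and
  loop-free set of arcs, an undirected edge \<open>uv\<close> being present as both \<open>(u, v)\<close> and \<open>(v, u)\<close>.
  The positive integers are the elements of \<^typ>\<open>nat\<close> that are at least 1.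
\<close>

definition dynamic_coprime_labeling ::
    "'a pair_pre_digraph \<Rightarrow> (nat \<Rightarrow> nat) \<Rightarrow> (nat \<Rightarrow> 'a \<Rightarrow> nat) \<Rightarrow> bool" where
  "dynamic_coprime_labeling G g f \<longleftrightarrow>
     (\<forall>t. f t ` pverts G \<subseteq> {1..}) \<and>
     (\<forall>t. inj_on (f t) (pverts G)) \<and>
     (\<forall>t. \<forall>v\<in>pverts G. f (Suc t) v = g (f t v)) \<and>
     (\<forall>t. \<forall>(u, v)\<in>parcs G. gcd (f t u) (f t v) = 1)"

text \<open>
  The subgroup of the unit group of the integers modulo \<open>q\<close> generated by the class of \<open>p\<close>, with
  classes represented by integers in \<open>{0..<q}\<close>. It is meaningful only if \<open>p\<close> is a unit modulo \<open>q\<close>: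
  \<^const>\<open>generate\<close> does not check that the generator lies in the carrier.
\<close>

definition cyclic_subgroup_mod :: "nat \<Rightarrow> nat \<Rightarrow> int set" where
  "cyclic_subgroup_mod q p = generate (units_of (residue_ring (int q))) {int p mod int q}"

end

theory Submission
  imports Defs
begin

text \<open>
  The quantity \<open>(p - 1) f\<^sub>t(u) + 1\<close> is multiplied by \<open>p\<close> in each step. If a prime \<open>q\<close> divides both
  \<open>f\<^sub>t(u)\<close> and \<open>f\<^sub>t(v)\<close> with \<open>t > 0\<close>, then \<open>q \<noteq> p\<close>, and \<open>q\<close> divides \<open>f\<^sub>0(v) - f\<^sub>0(u)\<close> because the difference of
  labels is also multiplied by \<open>p\<close>. Then \<open>p\<^sup>t ((p - 1) f\<^sub>0(u) + 1) = (p - 1) f\<^sub>t(u) + 1\<close> is \<open>1\<close> modulo \<open>q\<close>,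
  which puts \<open>(p - 1) f\<^sub>0(u) + 1\<close> in the subgroup generated by \<open>p\<close>.
\<close>

lemma power_mod_mem_cyclic_subgroup_mod:
  assumes "q > 1"
  shows "int p ^ k mod int q \<in> cyclic_subgroup_mod q p"
proof (induction k)
  case 0
  have "\<one>\<^bsub>units_of (residue_ring (int q))\<^esub> \<in> cyclic_subgroup_mod q p"
    unfolding cyclic_subgroup_mod_def by (rule generate.one)
  \<comment> \<open>The unit of \<open>residue_ring\<close> is literally \<open>1\<close>, and
    \<open>1 mod int q\<close> equals it because \<open>q > 1\<close>.\<close>
  then show ?case
    using assms by (simp add: units_of_def residue_ring_def)
next
  case (Suc k)
  have "int p mod int q \<in> cyclic_subgroup_mod q p"
    unfolding cyclic_subgroup_mod_def by (rule generate.incl) simp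
  then have "(int p mod int q) \<otimes>\<^bsub>units_of (residue_ring (int q))\<^esub> (int p ^ k mod int q)
      \<in> cyclic_subgroup_mod q p"
    using Suc unfolding cyclic_subgroup_mod_def by (rule generate.eng)
  then show ?case
    by (simp add: units_of_def residue_ring_def mod_mult_eq)
qed

text \<open>Here \<open>x\<close> inverts \<open>p ^ t\<close> modulo \<open>q\<close>. Fermat's
  little theorem rewrites this inverse as the power of \<open>p\<close> with natural exponent
  \<open>(q - 2) * t\<close>, so membership reduces to the case of ordinary powers.\<close>

lemma mem_cyclic_subgroup_mod_if_power_mult_cong_1:
  fixes x :: int
  assumes "prime q" "\<not> q dvd p" and inv: "[int p ^ t * x = 1] (mod int q)"
  shows "x mod int q \<in> cyclic_subgroup_mod q p"
proof -
  have "[p ^ (q - 1) = 1] (mod q)"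
    using assms(1,2) by (rule fermat_theorem)
  then have "[int p ^ (q - 1) = 1] (mod int q)"
    by (metis cong_int_iff of_nat_1 of_nat_power)
  then have "[(int p ^ (q - 1)) ^ t = 1 ^ t] (mod int q)"
    by (rule cong_pow)
  then have "[(int p ^ (q - 1)) ^ t * x = 1 * x] (mod int q)"
    by (intro cong_mult) simp_all
  moreover have "(int p ^ (q - 1)) ^ t * x = int p ^ ((q - 2) * t) * (int p ^ t * x)"
  proof -
    \<comment> \<open>Subtraction is truncated here; \<open>q \<ge> 2\<close> makes the identity
      valid.\<close>
    have "q - 1 = (q - 2) + 1"
      using prime_ge_2_nat[OF assms(1)] by simp
    then have "(q - 1) * t = (q - 2) * t + t"
      by (simp only: add_mult_distrib mult_1)
    then show ?thesis
      by (simp only: power_mult[symmetric] power_add mult.assoc)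
  qed
  moreover have "[int p ^ ((q - 2) * t) * (int p ^ t * x) = int p ^ ((q - 2) * t) * 1] (mod int q)"
    using inv by (intro cong_mult) simp_all
  ultimately have "[x = int p ^ ((q - 2) * t)] (mod int q)"
    by (metis cong_sym cong_trans mult_1 mult_1_right)
  then show ?thesis
    using power_mod_mem_cyclic_subgroup_mod[where k = "(q - 2) * t"] prime_gt_1_nat[OF assms(1)]
    by (simp add: cong_def)
qed

text \<open>For \<open>p \<noteq> 1\<close> the map has the rational fixed point
  \<open>-1/(p - 1)\<close>; \<open>(p - 1) * x + 1\<close> is the displacement from it, cleared of
  its denominator, so each step scales it by \<open>p\<close>.\<close>

lemma affine_funpow_invariant:
  fixes p x :: nat
  shows "(int p - 1) * int (((\<lambda>x. p * x + 1) ^^ t) x) + 1 = int p ^ t * ((int p - 1) * int x + 1)"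
proof (induction t)
  case (Suc t)
  let ?y = "((\<lambda>x. p * x + 1) ^^ t) x"
  have "(int p - 1) * int (((\<lambda>x. p * x + 1) ^^ Suc t) x) + 1 = int p * ((int p - 1) * int ?y + 1)"
    by (simp add: algebra_simps)
  then show ?case
    by (simp only: Suc power_Suc mult.assoc)
qed simp

lemma affine_funpow_diff:
  fixes p x y :: nat
  shows "int (((\<lambda>x. p * x + 1) ^^ t) y) - int (((\<lambda>x. p * x + 1) ^^ t) x)
    = int p ^ t * (int y - int x)"
proof (induction t)
  case (Suc t)
  let ?f = "(\<lambda>x. p * x + 1) ^^ t"
  have "int (((\<lambda>x. p * x + 1) ^^ Suc t) y) - int (((\<lambda>x. p * x + 1) ^^ Suc t) x)
      = int p * (int (?f y) - int (?f x))"
    by (simp add: algebra_simps)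
  then show ?case
    by (simp only: Suc power_Suc mult.assoc)
qed simp

text \<open>Solve the invariant for the iterate over the reals, where dividing by
  \<open>p - 1\<close> is legitimate.\<close>

lemma affine_funpow_closed_form:
  fixes p x :: nat
  assumes "p \<noteq> 1"
  shows "real (((\<lambda>x. p * x + 1) ^^ t) x) = real p ^ t * real x + (real p ^ t - 1) / (real p - 1)"
proof -
  have "real_of_int ((int p - 1) * int (((\<lambda>x. p * x + 1) ^^ t) x) + 1)
      = real_of_int (int p ^ t * ((int p - 1) * int x + 1))"
    by (simp only: affine_funpow_invariant)
  then have "(real p - 1) * real (((\<lambda>x. p * x + 1) ^^ t) x) + 1
      = real p ^ t * ((real p - 1) * real x + 1)"
    by simp
  moreover have "real p - 1 \<noteq> 0"
    using assms by simp
  ultimately show ?thesis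
    by (simp add: field_simps)
qed

lemma inj_affine_funpow:
  fixes p :: nat
  assumes "p \<noteq> 0"
  shows "inj ((\<lambda>x. p * x + 1) ^^ t)"
  using assms by (intro inj_fn) (simp add: inj_on_def)

lemma coprime_affine_funpow:
  fixes p x y :: nat
  assumes "prime p" "coprime x y"
    and avoid: "\<And>q. prime q \<Longrightarrow> q \<noteq> p \<Longrightarrow> int q dvd int y - int x \<Longrightarrow>
      ((int p - 1) * int x + 1) mod int q \<notin> cyclic_subgroup_mod q p"
  shows "coprime (((\<lambda>x. p * x + 1) ^^ t) x) (((\<lambda>x. p * x + 1) ^^ t) y)"
proof (cases t)
  case 0
  then show ?thesis
    using assms(2) by simp
next
  case (Suc s)
  let ?f = "(\<lambda>x. p * x + 1) ^^ t"
  show ?thesis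
  proof (rule ccontr)
    assume "\<not> coprime (?f x) (?f y)"
    then have "gcd (?f x) (?f y) \<noteq> 1"
      by (simp only: coprime_iff_gcd_eq_1 not_False_eq_True)
    then obtain q where "prime q" "q dvd gcd (?f x) (?f y)"
      using prime_factor_nat by blast
    then have q: "prime q" "q dvd ?f x" "q dvd ?f y"
      by (simp_all only: gcd_greatest_iff)
    \<comment> \<open>Since \<open>t = Suc s\<close>, the iterate is a multiple of \<open>p\<close>
      plus 1. An initial label may be divisible by \<open>p\<close>, hence the separate case
      \<open>t = 0\<close>.\<close>
    have "\<not> p dvd ?f x"
      using prime_gt_1_nat[OF assms(1)] by (simp add: Suc dvd_add_right_iff del: add_Suc_right)
    then have "q \<noteq> p"
      using q(2) by blast
    then have ndvd: "\<not> q dvd p"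
      using q(1) assms(1) by (blast dest: primes_dvd_imp_eq)
    have "int q dvd int (?f y) - int (?f x)"
      using q(2,3) by (intro dvd_diff) (simp_all only: int_dvd_int_iff)
    then have "int q dvd int p ^ t * (int y - int x)"
      by (simp only: affine_funpow_diff)
    \<comment> \<open>This lets the prime \<open>q\<close> pass from the product to the initial
      difference.\<close>
    moreover have "\<not> int q dvd int p ^ t"
      using ndvd q(1) by (metis int_dvd_int_iff of_nat_power prime_dvd_power)
    ultimately have "int q dvd int y - int x"
      using q(1) by (simp add: prime_dvd_mult_iff)
    \<comment> \<open>By the invariant the left side is \<open>(p - 1) * ?f x + 1\<close>, and
      \<open>q\<close> divides \<open>?f x\<close>.\<close>
    moreover have "[int p ^ t * ((int p - 1) * int x + 1) = 1] (mod int q)"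
      unfolding affine_funpow_invariant[symmetric] using q(2) by (simp add: cong_iff_dvd_diff)
    ultimately show False
      using avoid q(1) \<open>q \<noteq> p\<close> mem_cyclic_subgroup_mod_if_power_mult_cong_1[OF q(1) ndvd] by blast
  qed
qed

theorem mainTheorem10:
  fixes G :: "'a pair_pre_digraph"
    and f0 :: "'a \<Rightarrow> nat"
    and p :: nat
    and g :: "nat \<Rightarrow> nat"
    and f :: "nat \<Rightarrow> 'a \<Rightarrow> nat"
  assumes "pair_graph G"
    and "f0 ` pverts G \<subseteq> {1..}"
    and "inj_on f0 (pverts G)"
    and "\<forall>(u, v)\<in>parcs G. gcd (f0 u) (f0 v) = 1"
    and "prime p"
    and "g = (\<lambda>x. p * x + 1)"
    and "f = (\<lambda>t v. (g ^^ t) (f0 v))"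
    \<comment> \<open>For \<open>q = p\<close> the subgroup is undefined; that prime carries no condition.\<close>
    and "\<forall>(u, v)\<in>parcs G. \<forall>q::nat. prime q \<and> q \<noteq> p \<and> int q dvd \<bar>int (f0 v) - int (f0 u)\<bar> \<longrightarrow>
           ((int p - 1) * int (f0 u) + 1) mod int q \<notin> cyclic_subgroup_mod q p"
  shows "(\<forall>t. \<forall>v\<in>pverts G.
            real (f t v) = real p ^ t * real (f0 v) + (real p ^ t - 1) / (real p - 1)) \<and>
         (\<forall>t. \<forall>(u, v)\<in>parcs G. gcd (f t u) (f t v) = 1) \<and>
         (\<forall>t. inj_on (f t) (pverts G)) \<and>
         dynamic_coprime_labeling G g f"
proof -
  have f: "f t v = ((\<lambda>x. p * x + 1) ^^ t) (f0 v)" for t v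
    using assms(6,7) by simp
  have closed_form: "real (f t v) = real p ^ t * real (f0 v) + (real p ^ t - 1) / (real p - 1)" for t v
    using prime_gt_1_nat[OF assms(5)] affine_funpow_closed_form[of p t "f0 v"] by (simp add: f)
  have coprime: "gcd (f t u) (f t v) = 1" if "(u, v) \<in> parcs G" for t u v
    using coprime_affine_funpow[OF assms(5), of "f0 u" "f0 v" t] assms(4,8) that
    by (fastforce simp: f coprime_iff_gcd_eq_1)
  have inj: "inj_on (f t) (pverts G)" for t
  proof -
    have "inj ((\<lambda>x. p * x + 1) ^^ t)"
      using prime_gt_0_nat[OF assms(5)] by (intro inj_affine_funpow) simp
    then have "inj_on (((\<lambda>x. p * x + 1) ^^ t) \<circ> f0) (pverts G)"
      using assms(3) by (meson comp_inj_on inj_on_subset subset_UNIV)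
    then show ?thesis
      by (simp add: f inj_on_def)
  qed
  have pos: "f t v \<ge> 1" if "v \<in> pverts G" for t v
    \<comment> \<open>Only \<open>t = 0\<close> uses positivity of \<open>f0\<close>; later labels
      are successors.\<close>
    using assms(2) that by (cases t) (auto simp: f)
  have step: "f (Suc t) v = g (f t v)" for t v
    using assms(6) by (simp add: f)
  show ?thesis
    unfolding dynamic_coprime_labeling_def
    using closed_form coprime inj pos step by auto
qed

end
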